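(* For all $g,k\in\mathbb{N}$, there is a bipartite graph $G$ with girth at least $g$ that is not $k$-choosable even though every proper subgraph of $G$ has average degree at most $2(k-1)$.
   Context: Graphs are finite and simple; $\mathbb{N}$ is the set of positive integers. The girth of a graph is the length of a shortest cycle ($\infty$ if there is none). A graph $G$ is $k$-choosable if, for every assignment of a list $L(v)$ of $k$ colors to each vertex $v\in V(G)$, there is a proper coloring $f$ of $G$ with $f(v)\in L(v)$ for all $v$. The average degree of a (nonempty) graph $H$ is $2|E(H)|/|V(H)|$. A proper subgraph of $G$ is any subgraph with at least one vertex that is different from $G$ (obtained by deleting vertices and/or edges). *)

theory Defs
  imports Complex_Main "HOL-Library.Extended_Nat"
begin

text \<open>A graph is a pair of a vertex set and a set of edges, each edge being a two-element
  set of vertices; so there are no loops and no multiple edges.\<close>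

type_synonym 'a ugraph = "'a set \<times> 'a set set"

abbreviation verts :: "'a ugraph \<Rightarrow> 'a set" where
  "verts G \<equiv> fst G"

abbreviation edges :: "'a ugraph \<Rightarrow> 'a set set" where
  "edges G \<equiv> snd G"

definition finite_graph :: "'a ugraph \<Rightarrow> bool" where
  "finite_graph G \<longleftrightarrow> finite (verts G) \<and> (\<forall>e\<in>edges G. e \<subseteq> verts G \<and> card e = 2)"

definition subgraph :: "'a ugraph \<Rightarrow> 'a ugraph \<Rightarrow> bool" where
  "subgraph H G \<longleftrightarrow> finite_graph H \<and> verts H \<subseteq> verts G \<and> edges H \<subseteq> edges G"

definition proper_subgraph :: "'a ugraph \<Rightarrow> 'a ugraph \<Rightarrow> bool" where
  "proper_subgraph H G \<longleftrightarrow> subgraph H G \<and> verts H \<noteq> {} \<and> H \<noteq> G"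

definition bipartite :: "'a ugraph \<Rightarrow> bool" where
  "bipartite G \<longleftrightarrow> (\<exists>A B. A \<union> B = verts G \<and> A \<inter> B = {} \<and>
     (\<forall>e\<in>edges G. \<exists>a\<in>A. \<exists>b\<in>B. e = {a, b}))"

text \<open>A cycle is given by the list of its vertices in cyclic order, without repeating the
  first vertex at the end; its length is then the length of the list.\<close>

definition is_cycle :: "'a ugraph \<Rightarrow> 'a list \<Rightarrow> bool" where
  "is_cycle G p \<longleftrightarrow> 3 \<le> length p \<and> distinct p \<and>
     (\<forall>i<length p. {p ! i, p ! (Suc i mod length p)} \<in> edges G)"

text \<open>The infimum of the empty set in \<^typ>\<open>enat\<close> is \<open>\<infinity>\<close>, so acyclic graphs have infinite girth.\<close>

definition girth :: "'a ugraph \<Rightarrow> enat" where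
  "girth G = (INF p\<in>{p. is_cycle G p}. enat (length p))"

definition proper_coloring :: "'a ugraph \<Rightarrow> ('a \<Rightarrow> 'c) \<Rightarrow> bool" where
  "proper_coloring G f \<longleftrightarrow> (\<forall>u v. {u, v} \<in> edges G \<longrightarrow> f u \<noteq> f v)"

text \<open>Colors are natural numbers. For a finite graph only finitely many colors occur in the
  lists of an assignment, so any other infinite set of colors gives the same notion.\<close>

definition choosable :: "nat \<Rightarrow> 'a ugraph \<Rightarrow> bool" where
  "choosable k G \<longleftrightarrow>
     (\<forall>L :: 'a \<Rightarrow> nat set. (\<forall>v\<in>verts G. finite (L v) \<and> card (L v) = k) \<longrightarrow>
        (\<exists>f. proper_coloring G f \<and> (\<forall>v\<in>verts G. f v \<in> L v)))"

definition average_degree :: "'a ugraph \<Rightarrow> real" where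
  "average_degree H = 2 * real (card (edges H)) / real (card (verts H))"

end

theory Submission
  imports Defs "HOL-Library.Countable"
begin

text \<open>The graph is a rooted tree in which every leaf is joined to its parent and to \<open>r = k - 1\<close> further
  ancestors. The root has \<open>k\<close> children and every other internal vertex has \<open>k - 1\<close>.

  It is not \<open>k\<close>-choosable, because a coloring can be followed down the tree. The root has \<open>k\<close> colors
  and one child for each of them. Every other internal vertex has the color that led to it, which its
  parent uses, and \<open>k - 1\<close> new colors, again with one child for each. So a proper coloring singles out a
  path from the root to a leaf such that the leaf determines all colors on the path; these are distinct
  because the new colors of different levels differ. If the list of each leaf consists of the \<open>k\<close>
  colors that its neighbors have in the colorings leading to it, the leaf at the end of the path
  cannot be colored (lemma \<open>not_choosable\<close>). For \<open>k = 1\<close> the tree is a single edge without leaves, and the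
  path already breaks off at the child of the root, whose only color is that of the root.

  It is sparse, because one can charge each edge from an internal vertex to a child to the internal
  vertex, and each of the \<open>r\<close> additional edges to the leaf. Then every vertex pays for at
  most \<open>k - 1\<close> edges, and only the root for one more; a subgraph with average degree above \<open>2 (k - 1)\<close>
  has to contain the root and all edges charged to each of its vertices, and so, going down from the
  root, it is the whole graph (lemma \<open>proper_subgraph_sparse\<close>).

  It remains to choose the ancestors so that there is no short cycle, and so that the graph is
  bipartite. The latter holds if all leaves have even depth and the ancestors odd depth. For
  the girth, there is a double induction on the girth \<open>g\<close> and the number \<open>r\<close> of additional edges
  per leaf. Suppose a tree \<open>S\<close> with parameters \<open>g + 1\<close> and \<open>r\<close> has \<open>R\<close> leaves, and take a tree \<open>T\<close> with
  parameters \<open>g\<close> and \<open>R\<close>. Replace each leaf \<open>v\<close> of \<open>T\<close> by a copy of \<open>S\<close> and give the \<open>R\<close> additional edges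
  at \<open>v\<close> to the \<open>R\<close> leaves of the copy, one to each. Now each leaf has \<open>r + 1\<close> additional edges. A
  cycle inside a copy of \<open>S\<close> has length at least \<open>g + 1\<close>. Contracting the copies turns any other
  cycle into a closed trail of \<open>T\<close>. That trail uses an additional edge of \<open>T\<close>, whose end in the copy
  lies on no other edge that leaves the copy; so the contraction has lost an edge, and
  the cycle is longer than \<open>g\<close> (lemma \<open>even_girth_new\<close>).\<close>

section \<open>Even edge sets\<close>

definition even_edge_set :: "'a set set \<Rightarrow> bool" where
  "even_edge_set F \<longleftrightarrow> finite F \<and> (\<forall>v. even (card {e\<in>F. v \<in> e}))"

text \<open>Contraction does not map cycles to cycles, but it does map the elements of the cycle space,
  the edge sets with all degrees even, to elements of the cycle space. The girth is the least size of
  a nonempty element, so the girth is bounded below in this form throughout the construction.\<close>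

definition even_girth_ge :: "nat \<Rightarrow> 'a set set \<Rightarrow> bool" where
  "even_girth_ge g E \<longleftrightarrow> (\<forall>F\<subseteq>E. even_edge_set F \<and> F \<noteq> {} \<longrightarrow> g \<le> card F)"

lemma even_edge_set_second_edge:
  assumes "even_edge_set F" "e \<in> F" "v \<in> e"
  obtains e' where "e' \<in> F" "e' \<noteq> e" "v \<in> e'"
proof -
  have "{e'\<in>F. v \<in> e'} \<noteq> {e}"
    using assms(1) unfolding even_edge_set_def by (metis card.empty card_Suc_eq even_Suc even_zero equals0D)
  with assms that show thesis by blast
qed

lemma cycle_edges_even:
  assumes c: "is_cycle G p"
  defines "n \<equiv> length p"
  defines "F \<equiv> (\<lambda>i. {p ! i, p ! (Suc i mod n)}) ` {..<n}"
  shows "even_edge_set F"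
proof -
  have n3: "3 \<le> n" and dist: "distinct p"
    using c by (auto simp: is_cycle_def n_def)
  have inj: "p ! i = p ! j \<longleftrightarrow> i = j" if "i < n" "j < n" for i j
    using that dist by (simp add: n_def nth_eq_iff_index_eq)
  have "even (card {e\<in>F. v \<in> e})" for v
  proof (cases "v \<in> set p")
    case False
    then have "v \<noteq> p ! i" if "i < n" for i using that by (auto simp: n_def)
    moreover have "Suc i mod n < n" for i using n3 by simp
    ultimately have "{e\<in>F. v \<in> e} = {}" by (auto simp: F_def)
    then show ?thesis by (metis card.empty even_zero)
  next
    case True
    then obtain i where i: "i < n" "v = p ! i" by (auto simp: in_set_conv_nth n_def)
    \<comment> \<open>The neighbors of \<open>v\<close> on the cycle are at the positions \<open>i'\<close> and \<open>s\<close>; they differ because \<open>n \<ge> 3\<close>.\<close>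
    define i' where "i' = (if i = 0 then n - 1 else i - 1)"
    define s where "s = Suc i mod n"
    have s: "s < n" "s = (if Suc i = n then 0 else Suc i)" using i n3 by (auto simp: s_def)
    have i': "i' < n" "Suc i' mod n = i" "i' \<noteq> i" "i' \<noteq> s"
      using i n3 s by (auto simp: i'_def)
    have eq: "m = i'" if "m < n" "Suc m mod n = i" for m
      using that i n3 by (cases "Suc m = n") (auto simp: i'_def)
    have "{e\<in>F. v \<in> e} = {{p ! i, p ! s}, {p ! i', p ! i}}"
    proof (intro equalityI subsetI)
      fix e assume "e \<in> {e\<in>F. v \<in> e}"
      then obtain m where m: "m < n" "e = {p ! m, p ! (Suc m mod n)}" "v \<in> e"
        by (auto simp: F_def)
      have "Suc m mod n < n" using n3 by simp
      then have "m = i \<or> Suc m mod n = i" using m i inj[of i m] inj[of i "Suc m mod n"] by auto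
      then show "e \<in> {{p ! i, p ! s}, {p ! i', p ! i}}"
        using eq[OF m(1)] m i' by (auto simp: s_def)
    next
      fix e assume "e \<in> {{p ! i, p ! s}, {p ! i', p ! i}}"
      then show "e \<in> {e\<in>F. v \<in> e}" using i i' by (auto simp: F_def s_def)
    qed
    moreover have "{p ! i, p ! s} \<noteq> {p ! i', p ! i}"
      using inj i i' s by (auto simp: doubleton_eq_iff)
    ultimately show ?thesis by simp
  qed
  then show ?thesis by (auto simp: even_edge_set_def F_def)
qed

lemma girth_ge_if_even_girth_ge:
  assumes "even_girth_ge g (edges G)"
  shows "enat g \<le> girth G"
  unfolding girth_def
proof (rule INF_greatest)
  fix p assume "p \<in> {p. is_cycle G p}"
  then have c: "is_cycle G p" by simp
  let ?F = "(\<lambda>i. {p ! i, p ! (Suc i mod length p)}) ` {..<length p}"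
  have "?F \<subseteq> edges G" "?F \<noteq> {}" using c by (auto simp: is_cycle_def lessThan_empty_iff)
  then have "g \<le> card ?F"
    using assms cycle_edges_even[OF c] unfolding even_girth_ge_def by blast
  also have "\<dots> \<le> length p" using card_image_le[of "{..<length p}"] by (metis card_lessThan finite_lessThan)
  finally show "enat g \<le> enat (length p)" by simp
qed

lemma even_girth_ge_image:
  assumes h: "inj h" and g: "even_girth_ge g E"
  shows "even_girth_ge g (image h ` E)"
  unfolding even_girth_ge_def
proof (intro allI impI, elim conjE)
  fix F assume F: "F \<subseteq> image h ` E" "even_edge_set F" "F \<noteq> {}"
  then obtain F1 where F1: "F1 \<subseteq> E" "F = image h ` F1" by (meson subset_imageE)
  have inj: "inj_on (image h) S" for S
    using inj_on_subset[OF h subset_UNIV] by (rule inj_on_image)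
  have "card {e\<in>F1. x \<in> e} = card {e\<in>F. h x \<in> e}" for x
  proof -
    have "h x \<in> h ` e \<longleftrightarrow> x \<in> e" for e using h by (rule inj_image_mem_iff)
    then have "{e\<in>F. h x \<in> e} = image h ` {e\<in>F1. x \<in> e}" unfolding F1 by blast
    then show ?thesis using inj by (simp add: card_image)
  qed
  moreover have "finite F1"
    using F(2) inj by (auto simp: F1 even_edge_set_def dest: finite_imageD)
  ultimately have "even_edge_set F1" using F(2) by (simp add: even_edge_set_def)
  then have "g \<le> card F1" using g F F1 by (auto simp: even_girth_ge_def)
  then show "g \<le> card F" using inj by (simp add: F1 card_image)
qed

text \<open>The degree of a vertex \<open>v\<close> after the contraction is even, since modulo 2 it is the sum of the
  degrees over the fibre of \<open>v\<close>: edges inside the fibre count twice there, edges leaving it once.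
  Injectivity excludes parallel edges, which would become one edge here.\<close>

lemma even_edge_set_contract:
  assumes ev: "even_edge_set F"
    and card2: "\<And>e. e \<in> F \<Longrightarrow> card e = 2"
    and inj: "inj_on (image \<pi>) {e\<in>F. card (\<pi> ` e) = 2}"
  shows "even_edge_set (image \<pi> ` {e\<in>F. card (\<pi> ` e) = 2})"
proof -
  let ?Fo = "{e\<in>F. card (\<pi> ` e) = 2}"
  have fin: "finite F" using ev by (simp add: even_edge_set_def)
  have "even (card {e'\<in>image \<pi> ` ?Fo. v \<in> e'})" for v
  proof -
    \<comment> \<open>Only vertices on edges of \<open>F\<close> matter, and these are finitely many.\<close>
    define U where "U = {u\<in>\<Union>F. \<pi> u = v}"
    have "finite e" if "e \<in> F" for e
      using card2[OF that] card.infinite by fastforce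
    then have finU: "finite U" using fin by (simp add: U_def)
    have odd_iff: "odd (card (e \<inter> U)) \<longleftrightarrow> e \<in> ?Fo \<and> v \<in> \<pi> ` e" if e: "e \<in> F" for e
    proof -
      obtain a b where ab: "e = {a, b}" "a \<noteq> b" using card2[OF e] by (auto simp: card_2_iff)
      have "e \<inter> U = {u\<in>e. \<pi> u = v}" using e by (auto simp: U_def)
      also have "\<dots> = (if \<pi> a = v then {a} else {}) \<union> (if \<pi> b = v then {b} else {})"
        using ab by auto
      finally show ?thesis using ab e by (auto simp: card_insert_if)
    qed
    have "(\<Sum>e\<in>F. card (e \<inter> U)) = (\<Sum>e\<in>F. \<Sum>u\<in>U. if u \<in> e then 1 else 0)"
      using finU by (intro sum.cong) (simp_all add: sum.If_cases Int_commute)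
    also have "\<dots> = (\<Sum>u\<in>U. \<Sum>e\<in>F. if u \<in> e then 1 else 0)" by (rule sum.swap)
    also have "\<dots> = (\<Sum>u\<in>U. card {e\<in>F. u \<in> e})"
      using fin by (intro sum.cong) (simp_all add: sum.If_cases Int_def)
    finally have "even (\<Sum>e\<in>F. card (e \<inter> U))"
      using ev by (simp add: even_edge_set_def dvd_sum)
    then have "even (card {e\<in>F. odd (card (e \<inter> U))})"
      using fin by (simp add: even_sum_iff)
    also have "{e\<in>F. odd (card (e \<inter> U))} = {e\<in>?Fo. v \<in> \<pi> ` e}"
      using odd_iff by blast
    also have "card \<dots> = card (image \<pi> ` {e\<in>?Fo. v \<in> \<pi> ` e})"
      by (rule card_image[symmetric], rule inj_on_subset[OF inj]) blast
    also have "image \<pi> ` {e\<in>?Fo. v \<in> \<pi> ` e} = {e'\<in>image \<pi> ` ?Fo. v \<in> e'}" by blast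
    finally show ?thesis .
  qed
  then show ?thesis using fin by (simp add: even_edge_set_def)
qed

section \<open>Augmented trees\<close>

text \<open>A vertex of a tree is the list of child numbers on the path from the root to it. A tree is given
  by its set \<open>I\<close> of internal vertices: the root has \<open>D\<close> children, every other vertex in \<open>I\<close> has \<open>d\<close>
  children, and the children outside \<open>I\<close> are the leaves. Only the root may have another number of
  children, and this is needed twice: the final tree has \<open>D = d + 1\<close>, while a tree that replaces a leaf
  needs \<open>D = d\<close>. An ancestor of \<open>q\<close> is \<open>take j q\<close> for its depth \<open>j\<close>, so the additional neighbors of a leaf
  \<open>q\<close> are given by a set \<open>B q\<close> of depths.\<close>

definition kids :: "nat \<Rightarrow> nat \<Rightarrow> nat list \<Rightarrow> nat" where
  "kids D d p = (if p = [] then D else d)"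

definition leaves :: "nat \<Rightarrow> nat \<Rightarrow> nat list set \<Rightarrow> nat list set" where
  "leaves D d I = {p @ [i] |p i. p \<in> I \<and> i < kids D d p \<and> p @ [i] \<notin> I}"

text \<open>The edges are grouped by the vertex to which they are charged in the counting of
  \<open>proper_subgraph_sparse\<close>.\<close>

definition owned ::
  "nat \<Rightarrow> nat \<Rightarrow> nat list set \<Rightarrow> (nat list \<Rightarrow> nat set) \<Rightarrow> nat list \<Rightarrow> nat list set set" where
  "owned D d I B u =
     (if u \<in> I then (\<lambda>i. {u, u @ [i]}) ` {..<kids D d u} else (\<lambda>j. {take j u, u}) ` B u)"

definition aug_edges ::
  "nat \<Rightarrow> nat \<Rightarrow> nat list set \<Rightarrow> (nat list \<Rightarrow> nat set) \<Rightarrow> nat list set set" where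
  "aug_edges D d I B = (\<Union>u\<in>I \<union> leaves D d I. owned D d I B u)"

text \<open>Leaves at even depth and additional neighbors at odd depth make the graph bipartite. The bound
  \<open>Suc j < length q\<close> excludes the parent of \<open>q\<close>, which is adjacent to \<open>q\<close> already.\<close>

locale aug_tree =
  fixes D d r :: nat and I :: "nat list set" and B :: "nat list \<Rightarrow> nat set"
  assumes fin: "finite I"
    and root: "[] \<in> I"
    and closed: "p @ [i] \<in> I \<Longrightarrow> p \<in> I \<and> i < kids D d p"
    and even_leaf: "q \<in> leaves D d I \<Longrightarrow> even (length q)"
    and card_B: "q \<in> leaves D d I \<Longrightarrow> card (B q) = r"
    and B_odd: "q \<in> leaves D d I \<Longrightarrow> j \<in> B q \<Longrightarrow> odd j \<and> Suc j < length q"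
begin

abbreviation "Lf \<equiv> leaves D d I"
abbreviation "E \<equiv> aug_edges D d I B"

lemma append_closed: "p @ w \<in> I \<Longrightarrow> p \<in> I"
proof (induction w rule: rev_induct)
  case (snoc x xs)
  then show ?case using closed[of "p @ xs" x] by simp
qed simp

lemma take_closed: "p \<in> I \<Longrightarrow> take j p \<in> I"
  using append_closed[of "take j p" "drop j p"] by simp

lemma leaf_notin: "q \<in> Lf \<Longrightarrow> q \<notin> I"
  by (auto simp: leaves_def)

lemma leaf_nonempty: "q \<in> Lf \<Longrightarrow> q \<noteq> []"
  using leaf_notin root by blast

lemma leaf_take: "q \<in> Lf \<Longrightarrow> j < length q \<Longrightarrow> take j q \<in> I"
  by (auto simp: leaves_def take_closed)

lemma child_node: "p \<in> I \<Longrightarrow> i < kids D d p \<Longrightarrow> p @ [i] \<in> I \<union> Lf"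
  by (auto simp: leaves_def)

lemma finite_B: "q \<in> Lf \<Longrightarrow> finite (B q)"
  using B_odd by (meson finite_nat_set_iff_bounded Suc_lessD)

lemma finite_leaves: "finite Lf"
proof -
  have "Lf \<subseteq> (\<lambda>(p, i). p @ [i]) ` (I \<times> {..<max D d})"
    by (auto simp: leaves_def kids_def image_iff split: if_splits)
  then show ?thesis using fin by (meson finite_SigmaI finite_imageI finite_lessThan finite_subset)
qed

lemma leaf_prefix_node:
  assumes "v \<in> Lf" "v @ w \<in> I \<union> Lf"
  shows "w = [] \<and> v @ w \<in> Lf"
proof -
  have "v @ w \<notin> I" using assms append_closed leaf_notin by blast
  moreover have "w = []"
  proof (rule ccontr)
    assume "w \<noteq> []"
    then have "take (length v) (v @ w) \<in> I" using assms calculation by (intro leaf_take) auto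
    then show False using assms leaf_notin by simp
  qed
  ultimately show ?thesis using assms by auto
qed

lemma leaf_append_eq:
  assumes "v \<in> Lf" "v' \<in> Lf" "v @ w = v' @ w'"
  shows "v = v' \<and> w = w'"
proof -
  obtain us where "v = v' @ us \<or> v @ us = v'"
    using assms(3) by (auto simp: append_eq_append_conv2)
  then have "v = v'" using assms leaf_prefix_node by blast
  then show ?thesis using assms by simp
qed

lemma edge_cases:
  assumes "e \<in> E"
  obtains (tree) p i where "p \<in> I" "i < kids D d p" "e = {p, p @ [i]}"
  | (up) q j where "q \<in> Lf" "j \<in> B q" "e = {take j q, q}"
  using assms leaf_notin by (auto simp: aug_edges_def owned_def)

lemma tree_edge: "p \<in> I \<Longrightarrow> i < kids D d p \<Longrightarrow> {p, p @ [i]} \<in> E"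
  by (auto simp: aug_edges_def owned_def)

lemma back_edge: "q \<in> Lf \<Longrightarrow> j \<in> B q \<Longrightarrow> {take j q, q} \<in> E"
  using leaf_notin by (auto simp: aug_edges_def owned_def)

lemma edge_take:
  assumes "e \<in> E"
  obtains j q where "e = {take j q, q}" "j < length q" "q \<in> I \<union> Lf"
    "Suc j = length q \<or> q \<in> Lf \<and> j \<in> B q"
  using assms
proof (cases rule: edge_cases)
  case (tree p i)
  then show ?thesis using that[of "length p" "p @ [i]"] child_node by auto
next
  case (up q j)
  then show ?thesis using that[of j q] B_odd by fastforce
qed

lemma edge_verts: "e \<in> E \<Longrightarrow> e \<subseteq> I \<union> Lf \<and> card e = 2"
proof (elim edge_take)
  fix j q assume *: "e = {take j q, q}" "j < length q" "q \<in> I \<union> Lf"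
  have "take j q \<noteq> q" using *(2) by (metis length_take min.absorb4 less_irrefl)
  then show "e \<subseteq> I \<union> Lf \<and> card e = 2" using * take_closed leaf_take by auto
qed

lemma finite_E: "finite E"
  by (rule finite_subset[of _ "Pow (I \<union> Lf)"]) (use edge_verts fin finite_leaves in auto)

text \<open>The tree edges form a forest, so they contain no nonempty even set. Concretely, a deepest vertex
  \<open>q\<close> of an even set has at least two edges, all of them going up, and only one of them goes to its
  parent.\<close>

lemma even_set_has_back_edge:
  assumes F: "F \<subseteq> E" "even_edge_set F" "F \<noteq> {}"
  obtains q j where "q \<in> Lf" "j \<in> B q" "{take j q, q} \<in> F"
proof -
  let ?P = "\<lambda>q. \<exists>j<length q. {take j q, q} \<in> F"
  have "\<exists>q. ?P q" using F edge_take by (metis subsetD ex_in_conv)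
  moreover have "\<forall>q. ?P q \<longrightarrow> length q < Suc (Max (length ` (I \<union> Lf)))"
    using F edge_verts fin finite_leaves by (auto simp: less_Suc_eq_le intro!: Max_ge)
  ultimately obtain q where q: "?P q" and max: "\<And>q'. ?P q' \<Longrightarrow> length q' \<le> length q"
    using ex_has_greatest_nat[of ?P _ length] by metis
  then obtain j where j: "j < length q" "{take j q, q} \<in> F" by blast
  have short: "\<exists>j. e = {take j q, q} \<and> j < length q \<and> (Suc j = length q \<or> q \<in> Lf \<and> j \<in> B q)"
    if e: "e \<in> F" "q \<in> e" for e
  proof -
    obtain j' q' where e': "e = {take j' q', q'}" "j' < length q'"
      "Suc j' = length q' \<or> q' \<in> Lf \<and> j' \<in> B q'"
      using F e edge_take by (metis subsetD)
    moreover have "length q' \<le> length q" using max e e' by blast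
    then have "q \<noteq> take j' q'" using e'(2) by auto
    ultimately show ?thesis using e by auto
  qed
  obtain e' where "e' \<in> F" "e' \<noteq> {take j q, q}" "q \<in> e'"
    using even_edge_set_second_edge[OF F(2) j(2)] by blast
  with short[OF this(1,3)] short[OF j(2)] j obtain j1 j2
    where "{take j1 q, q} \<in> F" "{take j2 q, q} \<in> F" "j1 \<noteq> j2"
      "Suc j1 = length q \<or> q \<in> Lf \<and> j1 \<in> B q" "Suc j2 = length q \<or> q \<in> Lf \<and> j2 \<in> B q"
    by (smt (verit) insertCI)
  then show thesis using that by (metis Suc_inject)
qed

end

section \<open>Replacing leaves by trees\<close>

text \<open>Each leaf \<open>v\<close> of the tree \<open>T\<close> is replaced by a copy of \<open>S\<close> with root \<open>v\<close>, whose vertices are \<open>v @ w\<close> for the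
  vertices \<open>w\<close> of \<open>S\<close>. The bijection \<open>\<beta> v\<close> distributes the additional edges at \<open>v\<close> among the leaves of the
  copy.\<close>

locale leaf_replacement =
  T: aug_tree D d R I B + S: aug_tree d d r J C for D d R r I B J C +
  fixes \<beta> :: "nat list \<Rightarrow> nat list \<Rightarrow> nat"
  assumes bij: "v \<in> T.Lf \<Longrightarrow> bij_betw (\<beta> v) S.Lf (B v)"
begin

text \<open>This is the contraction of the new tree onto \<open>T\<close>. Leaves are not prefixes of each other, so the
  choice is unique.\<close>

definition host :: "nat list \<Rightarrow> nat list" where
  "host x = (if \<exists>v\<in>T.Lf. \<exists>w. x = v @ w then SOME v. v \<in> T.Lf \<and> (\<exists>w. x = v @ w) else x)"

definition new_I :: "nat list set" where
  "new_I = I \<union> {v @ w |v w. v \<in> T.Lf \<and> w \<in> J}"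

definition new_B :: "nat list \<Rightarrow> nat set" where
  "new_B x = (let v = host x; w = drop (length v) x in insert (\<beta> v w) ((+) (length v) ` C w))"

abbreviation "new_Lf \<equiv> leaves D d new_I"
abbreviation "new_E \<equiv> aug_edges D d new_I new_B"

lemma new_I_append: "v \<in> T.Lf \<Longrightarrow> w \<in> J \<Longrightarrow> v @ w \<in> new_I"
  unfolding new_I_def by blast

lemma leaf_in_new_I: "v \<in> T.Lf \<Longrightarrow> v \<in> new_I"
  using new_I_append[of v "[]"] S.root by simp

lemma new_I_cases:
  assumes "x \<in> new_I"
  obtains (old) "x \<in> I" | (blob) v w where "v \<in> T.Lf" "w \<in> J" "x = v @ w"
  using assms unfolding new_I_def by blast

lemma in_new_I: "u \<in> I \<Longrightarrow> u \<in> new_I"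
  by (simp add: new_I_def)

lemma host_append: "v \<in> T.Lf \<Longrightarrow> host (v @ w) = v"
proof -
  assume v: "v \<in> T.Lf"
  have "(SOME v'. v' \<in> T.Lf \<and> (\<exists>w'. v @ w = v' @ w')) = v"
    by (rule some_equality) (use v T.leaf_append_eq in blast)+
  then show ?thesis using v by (auto simp: host_def)
qed

lemma host_internal: "u \<in> I \<Longrightarrow> host u = u"
  using T.append_closed T.leaf_notin by (auto simp: host_def)

lemma host_leaf: "v \<in> T.Lf \<Longrightarrow> host v = v"
  using host_append[of v "[]"] by simp

lemma new_B_append:
  "v \<in> T.Lf \<Longrightarrow> new_B (v @ w) = insert (\<beta> v w) ((+) (length v) ` C w)"
  by (simp add: new_B_def host_append)

lemma \<beta>_in: "v \<in> T.Lf \<Longrightarrow> w \<in> S.Lf \<Longrightarrow> \<beta> v w \<in> B v"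
  using bij by (meson bij_betwE)

lemma \<beta>_bound: "v \<in> T.Lf \<Longrightarrow> w \<in> S.Lf \<Longrightarrow> odd (\<beta> v w) \<and> Suc (\<beta> v w) < length v"
  using \<beta>_in T.B_odd by blast

lemma new_leaves: "new_Lf = {v @ w |v w. v \<in> T.Lf \<and> w \<in> S.Lf}"
proof (intro equalityI subsetI)
  fix x assume "x \<in> new_Lf"
  then obtain p i where x: "x = p @ [i]" "p \<in> new_I" "i < kids D d p" "x \<notin> new_I"
    by (auto simp: leaves_def)
  show "x \<in> {v @ w |v w. v \<in> T.Lf \<and> w \<in> S.Lf}"
  proof (cases "p \<in> I")
    case True
    then have "x \<in> I \<union> T.Lf" using x T.child_node by blast
    then have "x \<in> new_I" using leaf_in_new_I in_new_I by blast
    then show ?thesis using x(4) by contradiction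
  next
    case False
    then obtain v w where vw: "v \<in> T.Lf" "w \<in> J" "p = v @ w"
      using x(2) by (auto elim: new_I_cases)
    then have "i < kids d d w" using x T.leaf_nonempty by (auto simp: kids_def split: if_splits)
    moreover have "w @ [i] \<notin> J" using x(1,4) vw new_I_append[of v "w @ [i]"] by auto
    ultimately have "w @ [i] \<in> S.Lf" using vw S.child_node by blast
    moreover have "x = v @ (w @ [i])" using x(1) vw(3) by simp
    ultimately show ?thesis using vw(1) by blast
  qed
next
  fix x assume "x \<in> {v @ w |v w. v \<in> T.Lf \<and> w \<in> S.Lf}"
  then obtain v w where vw: "v \<in> T.Lf" "w \<in> S.Lf" "x = v @ w" by blast
  then obtain u i where u: "w = u @ [i]" "u \<in> J" "i < kids d d u" by (auto simp: leaves_def)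
  have "x \<notin> I" using vw T.append_closed T.leaf_notin by blast
  moreover have "w \<notin> J" using vw S.leaf_notin by blast
  ultimately have "x \<notin> new_I"
    using vw T.leaf_append_eq[OF vw(1)] by (metis new_I_cases)
  moreover have "v @ u \<in> new_I" using vw(1) u(2) by (rule new_I_append)
  moreover have "i < kids D d (v @ u)"
    using u vw T.leaf_nonempty by (auto simp: kids_def split: if_splits)
  moreover have "x = (v @ u) @ [i]" using vw(3) u(1) by simp
  ultimately show "x \<in> new_Lf" unfolding leaves_def by blast
qed

lemma new_aug_tree: "aug_tree D d (Suc r) new_I new_B"
proof
  have "new_I = I \<union> (\<lambda>(v, w). v @ w) ` (T.Lf \<times> J)" by (auto simp: new_I_def)
  then show "finite new_I" using T.fin S.fin T.finite_leaves by simp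
  show "[] \<in> new_I" using T.root by (simp add: new_I_def)
next
  fix p i assume "p @ [i] \<in> new_I"
  then consider "p @ [i] \<in> I" | v w where "v \<in> T.Lf" "w \<in> J" "p @ [i] = v @ w"
    by (auto simp: new_I_def)
  then show "p \<in> new_I \<and> i < kids D d p"
  proof cases
    case 1
    then show ?thesis using T.closed by (auto simp: new_I_def)
  next
    case 2
    show ?thesis
    proof (cases w rule: rev_cases)
      case Nil
      then show ?thesis using 2 by (auto simp: leaves_def new_I_def)
    next
      case (snoc u j)
      then have "p = v @ u" "j = i" "u \<in> J" "i < kids d d u" using 2 S.closed by auto
      then show ?thesis using 2 T.leaf_nonempty
        by (auto simp: kids_def new_I_def split: if_splits)
    qed
  qed
next
  fix q assume "q \<in> new_Lf"
  then obtain v w where vw: "v \<in> T.Lf" "w \<in> S.Lf" "q = v @ w" by (auto simp: new_leaves)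
  then show "even (length q)" using T.even_leaf S.even_leaf by simp
  have "\<beta> v w \<notin> (+) (length v) ` C w" using \<beta>_bound vw by fastforce
  then show "card (new_B q) = Suc r"
    using vw S.finite_B S.card_B by (simp add: new_B_append card_image)
  fix j assume "j \<in> new_B q"
  then show "odd j \<and> Suc j < length q"
    using vw \<beta>_bound[of v w] S.B_odd[of w] T.even_leaf[of v] by (auto simp: new_B_append)
qed

lemma new_edge_cases:
  assumes "e \<in> new_E"
  obtains (outer) p i where "p \<in> I" "i < kids D d p" "e = {p, p @ [i]}"
  | (link) v w where "v \<in> T.Lf" "w \<in> S.Lf" "e = {take (\<beta> v w) v, v @ w}"
  | (inner) v e1 where "v \<in> T.Lf" "e1 \<in> S.E" "e = (@) v ` e1"
proof -
  interpret N: aug_tree D d "Suc r" new_I new_B by (rule new_aug_tree)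
  from assms show thesis
  proof (cases rule: N.edge_cases)
    case (tree p i)
    show thesis
    proof (cases "p \<in> I")
      case True
      then show thesis using tree outer by blast
    next
      case False
      then obtain v w where vw: "v \<in> T.Lf" "w \<in> J" "p = v @ w"
        using tree by (auto simp: new_I_def)
      then have "i < kids d d w"
        using tree T.leaf_nonempty by (auto simp: kids_def split: if_splits)
      then show thesis using inner[of v "{w, w @ [i]}"] vw tree S.tree_edge by simp
    qed
  next
    case (up q j)
    then obtain v w where vw: "v \<in> T.Lf" "w \<in> S.Lf" "q = v @ w" by (auto simp: new_leaves)
    then consider "j = \<beta> v w" | j' where "j' \<in> C w" "j = length v + j'"
      using up by (auto simp: new_B_append)
    then show thesis
    proof cases
      case 1
      then show thesis using link[of v w] vw up \<beta>_bound[of v w] by simp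
    next
      case 2
      then show thesis using inner[of v "{take j' w, w}"] vw up S.back_edge by simp
    qed
  qed
qed

lemma host_outer: "p \<in> I \<Longrightarrow> i < kids D d p \<Longrightarrow> host ` {p, p @ [i]} = {p, p @ [i]}"
  using T.child_node[of p i] host_internal host_leaf by auto

lemma host_link:
  "v \<in> T.Lf \<Longrightarrow> w \<in> S.Lf \<Longrightarrow> host ` {take (\<beta> v w) v, v @ w} = {take (\<beta> v w) v, v}"
  using \<beta>_bound[of v w] T.leaf_take[of v "\<beta> v w"] by (simp add: host_internal host_append)

lemma host_inner: "v \<in> T.Lf \<Longrightarrow> e \<noteq> {} \<Longrightarrow> host ` (@) v ` e = {v}"
  using host_append by (auto simp: image_iff)

lemma up_edge_eq:
  assumes "{take j v, v} = {take j' v', v'}" "j < length v" "j' < length v'"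
  shows "v = v' \<and> j = j'"
proof -
  have "length (take j v) < length v" "length (take j' v') < length v'" using assms by auto
  then have "v = v' \<and> take j v = take j' v'"
    using assms(1) by (metis doubleton_eq_iff less_asym)
  then show ?thesis using assms by (metis length_take min.absorb4)
qed

text \<open>An even set inside the copies of \<open>S\<close> restricts to an even set in one of them. Any other even set
  contracts to a nonempty even set of \<open>T\<close>, which has at least \<open>g\<close> edges and contains an additional
  edge of some leaf \<open>v\<close>. This edge comes from a leaf \<open>v @ w\<close> of the copy at \<open>v\<close>, which is on no other
  edge to the outside. So a second edge at \<open>v @ w\<close> is contracted, and the even set has more than \<open>g\<close>
  edges.\<close>

lemma even_girth_new:
  assumes gT: "even_girth_ge g T.E" and gS: "even_girth_ge (Suc g) S.E"
  shows "even_girth_ge (Suc g) new_E"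
  unfolding even_girth_ge_def
proof (intro allI impI, elim conjE)
  fix F assume F: "F \<subseteq> new_E" "even_edge_set F" "F \<noteq> {}"
  interpret N: aug_tree D d "Suc r" new_I new_B by (rule new_aug_tree)
  define Fo where "Fo = {e\<in>F. card (host ` e) = 2}"
  have finF: "finite F" using F by (simp add: even_edge_set_def)
  have Fo_cases: "(\<exists>p i. p \<in> I \<and> i < kids D d p \<and> e = {p, p @ [i]}) \<or>
      (\<exists>v w. v \<in> T.Lf \<and> w \<in> S.Lf \<and> e = {take (\<beta> v w) v, v @ w})" if "e \<in> Fo" for e
  proof -
    have "e \<in> new_E" using that F by (auto simp: Fo_def)
    then show ?thesis
    proof (cases rule: new_edge_cases)
      case (inner v e1)
      then have "e1 \<noteq> {}" using S.edge_verts[OF inner(2)] by auto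
      then have "host ` e = {v}" using host_inner[OF inner(1)] inner(3) by metis
      then have "card (host ` e) = 1" by simp
      then show ?thesis using that by (simp add: Fo_def)
    qed blast+
  qed
  \<comment> \<open>The edge \<open>e\<close> contracts to the edge from \<open>q\<close> up to depth \<open>j\<close>; tree edges of \<open>T\<close> are unchanged, and the
    lower end of an additional edge moves into the copy at \<open>q\<close>.\<close>
  define lifts where "lifts e j q \<longleftrightarrow> host ` e = {take j q, q} \<and> j < length q \<and>
      (Suc j = length q \<and> e = host ` e \<or>
       Suc j < length q \<and> (\<exists>w. q \<in> T.Lf \<and> w \<in> S.Lf \<and> j = \<beta> q w \<and> e = {take j q, q @ w}))"
    for e j q
  have lifts: "\<exists>j q. lifts e j q" if "e \<in> Fo" for e
    using Fo_cases[OF that]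
  proof (elim disjE exE conjE)
    fix p i assume "p \<in> I" "i < kids D d p" "e = {p, p @ [i]}"
    then show ?thesis using host_outer unfolding lifts_def
      by (intro exI[of _ "length p"] exI[of _ "p @ [i]"]) simp
  next
    fix v w assume "v \<in> T.Lf" "w \<in> S.Lf" "e = {take (\<beta> v w) v, v @ w}"
    then show ?thesis using host_link \<beta>_bound[of v w] unfolding lifts_def
      by (intro exI[of _ "\<beta> v w"] exI[of _ v]) auto
  qed
  have inj: "inj_on (image host) Fo"
  proof (rule inj_onI)
    fix e e' assume e: "e \<in> Fo" "e' \<in> Fo" and eq: "host ` e = host ` e'"
    obtain j q where q: "lifts e j q" using lifts[OF e(1)] by blast
    obtain j' q' where q': "lifts e' j' q'" using lifts[OF e(2)] by blast
    note q = q[unfolded lifts_def] and q' = q'[unfolded lifts_def]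
    have same: "q = q'" "j = j'" using up_edge_eq[of j q j' q'] q q' eq by auto
    show "e = e'"
    proof (cases "Suc j = length q")
      case True
      then show ?thesis using q q' same eq by auto
    next
      case False
      then obtain w w' where "q \<in> T.Lf" "w \<in> S.Lf" "w' \<in> S.Lf" "\<beta> q w = \<beta> q w'"
        "e = {take j q, q @ w}" "e' = {take j q, q @ w'}"
        using q q' same by auto
      then show ?thesis using bij[of q] by (metis bij_betw_def inj_onD)
    qed
  qed
  define F' where "F' = image host ` Fo"
  have F'E: "F' \<subseteq> T.E"
  proof
    fix e' assume "e' \<in> F'"
    then obtain e where e: "e \<in> Fo" "e' = host ` e" by (auto simp: F'_def)
    then show "e' \<in> T.E"
      using Fo_cases[OF e(1)] host_outer host_link T.tree_edge T.back_edge \<beta>_in by fastforce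
  qed
  have F'even: "even_edge_set F'"
    unfolding F'_def Fo_def
    by (rule even_edge_set_contract[OF F(2)]) (use N.edge_verts F inj in \<open>auto simp: Fo_def\<close>)
  have cardF': "card F' = card Fo" using inj by (simp add: F'_def card_image)
  have inner_if: "\<exists>v e1. v \<in> T.Lf \<and> e1 \<in> S.E \<and> e = (@) v ` e1" if e: "e \<in> F" "e \<notin> Fo" for e
  proof -
    have E: "e \<in> new_E" using e F by blast
    have ne: "card (host ` e) \<noteq> 2" using e by (simp add: Fo_def)
    from E show ?thesis
    proof (cases rule: new_edge_cases)
      case (outer p i)
      then show ?thesis using ne host_outer by simp
    next
      case (link v w)
      then have "take (\<beta> v w) v \<noteq> v" using \<beta>_bound by (metis Suc_lessD length_take min.absorb4 less_irrefl)
      then show ?thesis using ne host_link link by simp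
    qed blast
  qed
  show "Suc g \<le> card F"
  proof (cases "F' = {}")
    case True
    then have allinner: "\<exists>v e1. v \<in> T.Lf \<and> e1 \<in> S.E \<and> e = (@) v ` e1" if "e \<in> F" for e
      using inner_if that by (auto simp: F'_def)
    obtain e0 where "e0 \<in> F" using F by blast
    then obtain v e1 where v: "v \<in> T.Lf" "e1 \<in> S.E" "(@) v ` e1 \<in> F" using allinner by blast
    define Fv where "Fv = F \<inter> image ((@) v) ` S.E"
    have "even (card {e\<in>Fv. x \<in> e})" for x
    proof (cases "\<exists>w. x = v @ w")
      case True
      have "e \<in> Fv" if e: "e \<in> F" "x \<in> e" for e
      proof -
        obtain v' e1 where v': "v' \<in> T.Lf" "e1 \<in> S.E" "e = (@) v' ` e1"
          using allinner e by blast
        then obtain w' where "x = v' @ w'" using e(2) by auto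
        then have "v' = v" using True v(1) v'(1) T.leaf_append_eq by metis
        then show ?thesis using e v' by (simp add: Fv_def)
      qed
      then have "{e\<in>Fv. x \<in> e} = {e\<in>F. x \<in> e}" by (auto simp: Fv_def)
      then show ?thesis using F(2) by (simp add: even_edge_set_def)
    next
      case False
      then have "{e\<in>Fv. x \<in> e} = {}" by (auto simp: Fv_def)
      then show ?thesis by (metis card.empty even_zero)
    qed
    moreover have "Fv \<noteq> {}" "Fv \<subseteq> image ((@) v) ` S.E" "finite Fv"
      using v finF by (auto simp: Fv_def)
    moreover have "inj ((@) v)" by (simp add: inj_def)
    then have "even_girth_ge (Suc g) (image ((@) v) ` S.E)" using gS by (rule even_girth_ge_image)
    ultimately have "Suc g \<le> card Fv" by (simp add: even_girth_ge_def even_edge_set_def)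
    also have "\<dots> \<le> card F" using finF by (intro card_mono) (auto simp: Fv_def)
    finally show ?thesis .
  next
    case False
    then obtain v j where vj: "v \<in> T.Lf" "j \<in> B v" "{take j v, v} \<in> F'"
      using T.even_set_has_back_edge[OF F'E F'even] by blast
    then obtain e where e: "e \<in> Fo" "host ` e = {take j v, v}" by (auto simp: F'_def)
    obtain w where w: "w \<in> S.Lf" "e = {take (\<beta> v w) v, v @ w}"
    proof -
      obtain j' q' where "lifts e j' q'" using lifts[OF e(1)] by blast
      note q' = this[unfolded lifts_def]
      have "Suc j < length v" using T.B_odd vj by blast
      moreover from this have "v = v' \<and> j = j'" if "v' = q'" for v'
        using up_edge_eq[of j v j' q'] q' e that by auto
      ultimately show thesis using q' that by auto
    qed
    have "e \<in> F" using e by (simp add: Fo_def)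
    then obtain e2 where e2: "e2 \<in> F" "e2 \<noteq> e" "v @ w \<in> e2"
      using even_edge_set_second_edge[OF F(2)] w by (metis insertCI)
    have "e2 \<notin> Fo"
    proof
      assume "e2 \<in> Fo"
      from Fo_cases[OF this] show False
      proof (elim disjE exE conjE)
        fix p i assume p: "p \<in> I" "i < kids D d p" "e2 = {p, p @ [i]}"
        have "v @ w = p \<or> v @ w = p @ [i]" using e2(3) p(3) by simp
        then have "v @ w \<in> I \<union> T.Lf" using p(1) T.child_node[OF p(1,2)] by (metis UnI1)
        then have "w = []" using T.leaf_prefix_node[OF vj(1)] by blast
        then show False using S.leaf_nonempty w(1) by blast
      next
        fix v' w' assume v': "v' \<in> T.Lf" "w' \<in> S.Lf" "e2 = {take (\<beta> v' w') v', v' @ w'}"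
        have "take (\<beta> v' w') v' \<in> I" using v' \<beta>_bound[of v' w'] T.leaf_take by simp
        then have "v @ w \<noteq> take (\<beta> v' w') v'"
          using T.append_closed[of v w] T.leaf_notin[OF vj(1)] by metis
        then have "v @ w = v' @ w'" using v'(3) e2(3) by blast
        then have "v = v' \<and> w = w'" using T.leaf_append_eq[OF vj(1) v'(1)] by blast
        then show False using v'(3) e2(2) w(2) by metis
      qed
    qed
    then have "Fo \<subset> F" using e2 by (auto simp: Fo_def)
    then have "card Fo < card F" using finF psubset_card_mono by blast
    moreover have "g \<le> card F'" using gT F'E F'even False by (simp add: even_girth_ge_def)
    ultimately show ?thesis using cardF' by simp
  qed
qed

end


section \<open>Augmented trees of large girth\<close>

definition full_tree :: "nat \<Rightarrow> nat \<Rightarrow> nat \<Rightarrow> nat list set" where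
  "full_tree D d h = {p. length p < h \<and> (\<forall>i<length p. p ! i < kids D d (take i p))}"

text \<open>At height \<open>2 r + 2\<close> the odd depths below the depth \<open>2 r + 1\<close> of the leaves' parents are
  \<open>1, 3, \<dots>, 2 r - 1\<close>, which are exactly \<open>r\<close> depths.\<close>

lemma full_aug_tree:
  "aug_tree D d r (full_tree D d (2 * r + 2)) (\<lambda>_. (\<lambda>i. 2 * i + 1) ` {..<r})"
proof
  let ?h = "2 * r + 2"
  have "full_tree D d ?h \<subseteq> {p. set p \<subseteq> {..<max D d} \<and> length p \<le> ?h}"
  proof
    fix p assume p: "p \<in> full_tree D d ?h"
    have "x < max D d" if "x \<in> set p" for x
      using that p by (fastforce simp: full_tree_def in_set_conv_nth kids_def split: if_splits)
    then show "p \<in> {p. set p \<subseteq> {..<max D d} \<and> length p \<le> ?h}"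
      using p by (auto simp: full_tree_def)
  qed
  then show "finite (full_tree D d ?h)"
    using finite_lists_length_le[of "{..<max D d}" ?h] finite_subset by blast
  show "[] \<in> full_tree D d ?h" by (simp add: full_tree_def)
  have snoc: "p @ [i] \<in> full_tree D d h \<longleftrightarrow>
      Suc (length p) < h \<and> p \<in> full_tree D d h \<and> i < kids D d p" for p i h
    by (auto simp: full_tree_def nth_append less_Suc_eq)
  show "p \<in> full_tree D d ?h \<and> i < kids D d p" if "p @ [i] \<in> full_tree D d ?h" for p i
    using that snoc by blast
  fix q assume "q \<in> leaves D d (full_tree D d ?h)"
  then obtain p i where "q = p @ [i]" "p \<in> full_tree D d ?h" "\<not> Suc (length p) < ?h"
    by (auto simp: leaves_def snoc)
  then have len: "length q = ?h" by (auto simp: full_tree_def)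
  then show "even (length q)" by simp
  show "card ((\<lambda>i. 2 * i + 1) ` {..<r}) = r"
    by (simp add: card_image inj_on_def)
  fix j assume "j \<in> (\<lambda>i. 2 * i + 1) ` {..<r}"
  then show "odd j \<and> Suc j < length q" using len by auto
qed

text \<open>In the step, \<open>T\<close> comes from the outer induction hypothesis, with as many additional edges per leaf
  as \<open>S\<close> has leaves; so that hypothesis has to hold for all \<open>r\<close>. The inner one has to hold for all \<open>D\<close>,
  as it provides \<open>S\<close> with \<open>D = d\<close>.\<close>

theorem aug_tree_of_large_girth:
  "\<exists>I B. aug_tree D d r I B \<and> even_girth_ge g (aug_edges D d I B)"
proof (induction g arbitrary: D r)
  case 0
  have "even_girth_ge 0 E" for E :: "nat list set set" by (simp add: even_girth_ge_def)
  then show ?case using full_aug_tree by blast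
next
  case (Suc g)
  show ?case
  proof (induction r arbitrary: D)
    case 0
    let ?I = "full_tree D d 2" and ?B = "\<lambda>_. {}"
    interpret aug_tree D d 0 ?I ?B using full_aug_tree[of D d 0] by (simp add: numeral_2_eq_2)
    have "even_girth_ge (Suc g) (aug_edges D d ?I ?B)"
      unfolding even_girth_ge_def using even_set_has_back_edge by blast
    then show ?case using aug_tree_axioms by blast
  next
    case (Suc r)
    obtain J C where J: "aug_tree d d r J C" "even_girth_ge (Suc g) (aug_edges d d J C)"
      using Suc.IH by blast
    obtain I B where I: "aug_tree D d (card (leaves d d J)) I B"
      "even_girth_ge g (aug_edges D d I B)"
      using \<open>\<And>r D. \<exists>I B. aug_tree D d r I B \<and> even_girth_ge g (aug_edges D d I B)\<close> by blast
    interpret T: aug_tree D d "card (leaves d d J)" I B by (rule I)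
    interpret S: aug_tree d d r J C by (rule J)
    have "\<forall>v\<in>T.Lf. \<exists>b. bij_betw b S.Lf (B v)"
      using T.finite_B T.card_B S.finite_leaves by (auto intro: finite_same_card_bij)
    then obtain \<beta> where "\<And>v. v \<in> T.Lf \<Longrightarrow> bij_betw (\<beta> v) S.Lf (B v)" by metis
    then interpret leaf_replacement D d "card (leaves d d J)" r I B J C \<beta>
      by unfold_locales
    show ?case using new_aug_tree even_girth_new I J by blast
  qed
qed

section \<open>Colorings and density\<close>

context aug_tree
begin

abbreviation "graph \<equiv> (I \<union> Lf, E)"

lemma finite_graph: "finite_graph graph"
  using fin finite_leaves edge_verts by (auto simp: finite_graph_def)

lemma bipartite: "bipartite graph"
  unfolding bipartite_def
proof (intro exI conjI ballI)
  let ?X = "{p\<in>I \<union> Lf. even (length p)}" and ?Y = "{p\<in>I \<union> Lf. odd (length p)}"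
  show "?X \<union> ?Y = verts graph" "?X \<inter> ?Y = {}" by auto
  fix e assume "e \<in> edges graph"
  then have e: "e \<in> E" by simp
  then obtain u v where uv: "e = {u, v}" "even (length u)" "odd (length v)"
  proof (cases rule: edge_cases)
    case (tree p i)
    then show ?thesis using that[of p "p @ [i]"] that[of "p @ [i]" p] by (cases "even (length p)") auto
  next
    case (up q j)
    then show ?thesis using that[of q "take j q"] even_leaf B_odd[of q j] by (simp add: insert_commute)
  qed
  then show "\<exists>a\<in>?X. \<exists>b\<in>?Y. e = {a, b}" using edge_verts[OF e] by auto
qed

lemma parent_edge:
  assumes "q \<in> I \<union> Lf" "q \<noteq> []"
  shows "{take (length q - 1) q, q} \<in> E"
proof -
  obtain p i where q: "q = p @ [i]" using assms(2) by (metis rev_exhaust)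
  then have "p \<in> I \<and> i < kids D d p" using assms closed by (auto simp: leaves_def)
  then show ?thesis using q tree_edge by simp
qed

text \<open>The new colors of a vertex \<open>q\<close> are the codes of \<open>(length q, i)\<close> for its children \<open>i\<close>, so \<open>c q j\<close> is the
  color of the ancestor \<open>take j q\<close> that leads towards \<open>q\<close>. The deepest vertex \<open>q\<close> all of whose proper
  ancestors have the color leading towards \<open>q\<close> can only be a leaf, and a leaf of this kind has no color
  left.\<close>

lemma not_choosable:
  assumes D: "D = Suc r" and d: "d = r"
  shows "\<not> choosable (Suc r) graph"
proof
  assume ch: "choosable (Suc r) graph"
  define c where "c q j = prod_encode (j, q ! j)" for q :: "nat list" and j
  define L where "L q =
     (if q \<in> Lf then c q ` insert (length q - 1) (B q)
      else (if q = [] then {} else {c q (length q - 1)}) \<union>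
        (\<lambda>i. prod_encode (length q, i)) ` {..<kids D d q})" for q
  have "finite (L q) \<and> card (L q) = Suc r" if q: "q \<in> I \<union> Lf" for q
  proof (cases "q \<in> Lf")
    case True
    have "inj_on (c q) (insert (length q - 1) (B q))" by (auto simp: inj_on_def c_def)
    then have "card (L q) = card (insert (length q - 1) (B q))"
      using True by (simp only: L_def if_True card_image)
    moreover have "length q - 1 \<notin> B q" using B_odd[OF True] by fastforce
    ultimately show ?thesis
      using True finite_B card_B by (simp add: L_def)
  next
    case False
    define N where "N = (\<lambda>i. prod_encode (length q, i)) ` {..<kids D d q}"
    have "finite N" "card N = kids D d q" by (simp_all add: N_def card_image inj_on_def)
    moreover have "c q (length q - 1) \<notin> N" if "q \<noteq> []"
      using that by (cases q) (auto simp: c_def N_def)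
    moreover have "L q = (if q = [] then {} else {c q (length q - 1)}) \<union> N"
      using False by (simp add: L_def N_def)
    ultimately show ?thesis by (cases "q = []") (simp_all add: kids_def D d)
  qed
  then obtain f where f: "proper_coloring graph f" "\<And>v. v \<in> I \<union> Lf \<Longrightarrow> f v \<in> L v"
    using ch unfolding choosable_def by (metis fst_conv)
  have adj: "f u \<noteq> f v" if "{u, v} \<in> E" for u v
    using f(1) that by (simp add: proper_coloring_def)
  define reached where
    "reached q \<longleftrightarrow> q \<in> I \<union> Lf \<and> (\<forall>j<length q. f (take j q) = c q j)" for q
  have "reached []" using root by (simp add: reached_def)
  moreover have "\<forall>q. reached q \<longrightarrow> length q < Suc (Max (length ` (I \<union> Lf)))"
    using fin finite_leaves by (auto simp: reached_def less_Suc_eq_le intro!: Max_ge)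
  ultimately obtain q where q: "reached q" and max: "\<And>q'. reached q' \<Longrightarrow> length q' \<le> length q"
    using ex_has_greatest_nat[of reached _ length] by metis
  have node: "q \<in> I \<union> Lf" and col: "\<And>j. j < length q \<Longrightarrow> f (take j q) = c q j"
    using q by (auto simp: reached_def)
  have parent: "f q \<noteq> c q (length q - 1)" if "q \<noteq> []"
    using adj[OF parent_edge[OF node that]] col[of "length q - 1"] that by simp
  show False
  proof (cases "q \<in> Lf")
    case True
    then obtain j where j: "j \<in> B q" "f q = c q j"
      using f(2)[OF node] parent leaf_nonempty by (auto simp: L_def)
    then show False using adj[OF back_edge[OF True j(1)]] col[of j] B_odd[OF True j(1)] by simp
  next
    case False
    then obtain i where i: "i < kids D d q" "f q = prod_encode (length q, i)"
      using f(2)[OF node] parent by (auto simp: L_def split: if_splits)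
    have "f (take j (q @ [i])) = c (q @ [i]) j" if "j < length (q @ [i])" for j
      using that i col[of j] by (cases "j = length q") (auto simp: c_def nth_append)
    then have "reached (q @ [i])"
      using i node False child_node by (auto simp: reached_def)
    then show False using max by fastforce
  qed
qed

text \<open>If \<open>H\<close> had more than \<open>r * card (verts H)\<close> edges, then \<open>H\<close> would contain the root and, for each of
  its vertices, all edges charged to it: the total capacity \<open>sum cap W\<close> exceeds \<open>r * card W\<close> by at most
  one, so nothing can be missing. With a vertex, \<open>H\<close> then contains all its children, hence every vertex
  and every edge.\<close>

lemma proper_subgraph_sparse:
  assumes D: "D = Suc r" and d: "d = r" and H: "proper_subgraph H graph"
  shows "card (edges H) \<le> r * card (verts H)"
proof (rule ccontr)
  assume dense: "\<not> card (edges H) \<le> r * card (verts H)"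
  let ?own = "owned D d I B"
  define W X where "W = verts H" and "X = edges H"
  have sub: "W \<subseteq> I \<union> Lf" "X \<subseteq> E" and finW: "finite W" and XW: "\<And>e. e \<in> X \<Longrightarrow> e \<subseteq> W"
    using H by (auto simp: proper_subgraph_def subgraph_def finite_graph_def W_def X_def)
  have finX: "finite X" using sub finite_E finite_subset by blast
  have own_in: "u \<in> e" if "e \<in> ?own u" for u e
    using that by (auto simp: owned_def split: if_splits)
  define cap where "cap u = r + (if u = [] then 1 else 0)" for u :: "nat list"
  have cap: "finite (?own u) \<and> card (?own u) \<le> cap u" if "u \<in> I \<union> Lf" for u
  proof (cases "u \<in> I")
    case True
    have "card ((\<lambda>i. {u, u @ [i]}) ` {..<kids D d u}) \<le> kids D d u"
      by (metis card_image_le card_lessThan finite_lessThan)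
    then show ?thesis using True by (auto simp: owned_def cap_def kids_def D d)
  next
    case False
    then have "u \<in> Lf" using that by blast
    then show ?thesis using False finite_B card_B card_image_le[of "B u"]
      by (metis (no_types, lifting) cap_def finite_imageI owned_def trans_le_add1)
  qed
  have le: "card (X \<inter> ?own u) \<le> cap u" if "u \<in> W" for u
    using cap[of u] sub that card_mono[of "?own u" "X \<inter> ?own u"] by fastforce
  have sum_cap: "sum cap W = r * card W + (if [] \<in> W then 1 else 0)"
    using finW by (simp add: cap_def sum.distrib mult.commute)
  have "X \<subseteq> (\<Union>u\<in>W. X \<inter> ?own u)"
    using sub XW own_in by (fastforce simp: aug_edges_def)
  then have "card X \<le> card (\<Union>u\<in>W. X \<inter> ?own u)"
    using finW finX by (intro card_mono) auto
  also have "\<dots> \<le> (\<Sum>u\<in>W. card (X \<inter> ?own u))" using finW by (rule card_UN_le)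
  finally have many: "r * card W < (\<Sum>u\<in>W. card (X \<inter> ?own u))"
    using dense by (simp add: W_def X_def)
  also have "\<dots> \<le> sum cap W" using le by (rule sum_mono)
  finally have rootW: "[] \<in> W" using sum_cap by (auto split: if_splits)
  have full: "?own u \<subseteq> X" if u: "u \<in> W" for u
  proof -
    have "card (X \<inter> ?own u) = cap u"
    proof (rule ccontr)
      assume "card (X \<inter> ?own u) \<noteq> cap u"
      then have "(\<Sum>u\<in>W. card (X \<inter> ?own u)) < sum cap W"
        using le u finW by (intro sum_strict_mono_ex1) (auto simp: order_less_le)
      then show False using many sum_cap rootW by simp
    qed
    then have "X \<inter> ?own u = ?own u"
      using cap[of u] u sub by (intro card_seteq) auto
    then show ?thesis by blast
  qed
  have "q \<in> W" if "q \<in> I \<union> Lf" for q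
    using that
  proof (induction q rule: rev_induct)
    case Nil
    show ?case by (rule rootW)
  next
    case (snoc i p)
    then have p: "p \<in> I" "i < kids D d p" using closed by (auto simp: leaves_def)
    then have "{p, p @ [i]} \<in> ?own p" by (auto simp: owned_def)
    then show ?case using full[of p] snoc.IH p XW by blast
  qed
  then have "W = I \<union> Lf" using sub by blast
  moreover from this have "X = E" using full sub by (auto simp: aug_edges_def)
  ultimately have "H = graph" by (simp add: W_def X_def prod_eq_iff)
  then show False using H by (simp add: proper_subgraph_def)
qed

end

section \<open>Relabelling the vertices\<close>

definition relabel :: "('a \<Rightarrow> 'b) \<Rightarrow> 'a ugraph \<Rightarrow> 'b ugraph" where
  "relabel h G = (h ` verts G, image h ` edges G)"

context
  fixes h :: "'a \<Rightarrow> 'b"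
  assumes h: "inj h"
begin

lemma finite_graph_relabel: "finite_graph G \<Longrightarrow> finite_graph (relabel h G)"
  by (auto simp: finite_graph_def relabel_def card_image[OF inj_on_subset[OF h subset_UNIV]])

lemma bipartite_relabel:
  assumes "bipartite G"
  shows "bipartite (relabel h G)"
proof -
  obtain X Y where "X \<union> Y = verts G" "X \<inter> Y = {}" "\<forall>e\<in>edges G. \<exists>a\<in>X. \<exists>b\<in>Y. e = {a, b}"
    using assms by (auto simp: bipartite_def)
  note XY = this
  have "h ` X \<union> h ` Y = verts (relabel h G)" "h ` X \<inter> h ` Y = {}"
    using XY(1,2) by (simp_all add: relabel_def image_Un[symmetric] image_Int[OF h, symmetric])
  moreover have "\<exists>a\<in>h ` X. \<exists>b\<in>h ` Y. e = {a, b}" if e: "e \<in> edges (relabel h G)" for e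
  proof -
    obtain e' where e': "e' \<in> edges G" "e = h ` e'" using e by (auto simp: relabel_def)
    then obtain a b where "a \<in> X" "b \<in> Y" "e' = {a, b}" using XY(3) by blast
    then show ?thesis using e'(2) by auto
  qed
  ultimately show ?thesis
    unfolding bipartite_def by (intro exI[of _ "h ` X"] exI[of _ "h ` Y"]) simp
qed

lemma choosable_relabel:
  assumes "choosable k (relabel h G)"
  shows "choosable k G"
  unfolding choosable_def
proof (intro allI impI)
  fix L :: "'a \<Rightarrow> nat set" assume L: "\<forall>v\<in>verts G. finite (L v) \<and> card (L v) = k"
  have lists: "\<forall>v\<in>verts (relabel h G). finite (L (inv h v)) \<and> card (L (inv h v)) = k"
    using L h by (auto simp: relabel_def)
  have "\<exists>f. proper_coloring (relabel h G) f \<and> (\<forall>v\<in>verts (relabel h G). f v \<in> L' v)"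
    if "\<forall>v\<in>verts (relabel h G). finite (L' v) \<and> card (L' v) = k" for L' :: "'b \<Rightarrow> nat set"
    by (rule assms[unfolded choosable_def, THEN spec, THEN mp, OF that])
  from this[OF lists] obtain f where f: "proper_coloring (relabel h G) f"
    "\<forall>v\<in>verts (relabel h G). f v \<in> L (inv h v)"
    by blast
  have "{h u, h v} \<in> edges (relabel h G)" if "{u, v} \<in> edges G" for u v
    using imageI[OF that, of "image h"] by (simp add: relabel_def)
  then have "proper_coloring G (f \<circ> h)"
    using f(1) by (simp add: proper_coloring_def)
  moreover have "\<forall>v\<in>verts G. (f \<circ> h) v \<in> L v" using f(2) h by (simp add: relabel_def)
  ultimately show "\<exists>f. proper_coloring G f \<and> (\<forall>v\<in>verts G. f v \<in> L v)"
    by (intro exI[of _ "f \<circ> h"] conjI)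
qed

lemma proper_subgraph_relabel:
  assumes "proper_subgraph H (relabel h G)"
  obtains H' where "proper_subgraph H' G" "H = relabel h H'"
proof -
  have "verts H \<subseteq> h ` verts G" "edges H \<subseteq> image h ` edges G"
    using assms by (auto simp: proper_subgraph_def subgraph_def relabel_def)
  then obtain W X where W: "W \<subseteq> verts G" "verts H = h ` W"
    and X: "X \<subseteq> edges G" "edges H = image h ` X"
    by (elim subset_imageE)
  have H: "H = relabel h (W, X)" using W X by (simp add: relabel_def prod_eq_iff)
  have "finite (h ` W)" and XW: "\<And>e. e \<in> X \<Longrightarrow> h ` e \<subseteq> h ` W \<and> card (h ` e) = 2"
    using assms by (auto simp: proper_subgraph_def subgraph_def finite_graph_def W(2) X(2))
  have inj: "inj_on h S" for S using h by (rule inj_on_subset) simp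
  have "finite W" using \<open>finite (h ` W)\<close> inj by (rule finite_imageD)
  moreover have "e \<subseteq> W \<and> card e = 2" if "e \<in> X" for e
    using XW[OF that] card_image[OF inj, of e] inj_image_subset_iff[OF h, of e W] by simp
  ultimately have "finite_graph (W, X)" by (simp add: finite_graph_def)
  moreover have "(W, X) \<noteq> G" "W \<noteq> {}"
    using assms H W(2) unfolding proper_subgraph_def by blast+
  ultimately have "proper_subgraph (W, X) G"
    using W(1) X(1) by (simp add: proper_subgraph_def subgraph_def)
  then show thesis using H by (rule that)
qed

lemma average_degree_relabel: "average_degree (relabel h H) = average_degree H"
proof -
  have "inj_on h S" for S using h by (rule inj_on_subset) simp
  moreover from this have "inj_on (image h) S" for S by (rule inj_on_image)
  ultimately show ?thesis by (simp add: average_degree_def relabel_def card_image)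
qed

end

theorem theorem1p2:
  fixes g k :: nat
  assumes "g \<ge> 1" and "k \<ge> 1"
  shows "\<exists>G :: nat ugraph. finite_graph G \<and> bipartite G \<and> girth G \<ge> enat g \<and>
           \<not> choosable k G \<and>
           (\<forall>H. proper_subgraph H G \<longrightarrow> average_degree H \<le> 2 * (real k - 1))"
proof -
  obtain r where k: "k = Suc r" using assms(2) by (cases k) auto
  obtain I B where tree: "aug_tree (Suc r) r r I B"
    and gir: "even_girth_ge g (aug_edges (Suc r) r I B)"
    using aug_tree_of_large_girth by blast
  interpret aug_tree "Suc r" r r I B by (rule tree)
  let ?h = "to_nat :: nat list \<Rightarrow> nat"
  have h: "inj ?h" by simp
  have "enat g \<le> girth (relabel ?h graph)"
    using even_girth_ge_image[OF h gir] by (intro girth_ge_if_even_girth_ge) (simp add: relabel_def)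
  moreover have "average_degree H \<le> 2 * (real k - 1)"
    if "proper_subgraph H (relabel ?h graph)" for H
  proof -
    obtain H' where H': "proper_subgraph H' graph" "H = relabel ?h H'"
      using proper_subgraph_relabel[OF h \<open>proper_subgraph H (relabel ?h graph)\<close>] .
    have "card (verts H') > 0"
      using H'(1) by (auto simp: proper_subgraph_def subgraph_def finite_graph_def card_gt_0_iff)
    moreover have "real (card (edges H')) \<le> real r * real (card (verts H'))"
      using proper_subgraph_sparse[OF refl refl H'(1)] by (metis of_nat_le_iff of_nat_mult)
    ultimately have "average_degree H' \<le> 2 * real r"
      by (simp add: average_degree_def divide_le_eq)
    then show ?thesis using H' average_degree_relabel[OF h] by (simp add: k)
  qed
  moreover have "\<not> choosable k (relabel ?h graph)"
    using choosable_relabel[OF h] not_choosable k by blast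
  ultimately show ?thesis
    using finite_graph_relabel[OF h finite_graph] bipartite_relabel[OF h bipartite] by blast
qed

end
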